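(* Let $n\ge 3$ be an integer and let $C_n$ be the cycle of length $n$. Then $$C_n\in \mathrm{FCH}\Bigl(2+\Bigl\lfloor \frac{n}{2}\Bigr\rfloor^{-1}\Bigr).$$ Moreover, $$\mathrm{fchr}(C_n)=2+\Bigl\lfloor \frac{n}{2}\Bigr\rfloor^{-1}.$$
   Context: Graphs are finite and simple. The cycle $C_n$ of length $n\ge 3$ has vertex set $\{v_0,\dots,v_{n-1}\}$ and edges $v_iv_{i+1 \pmod n}$ for $0\le i\le n-1$. Throughout, $a\ge b\ge 1$ are integers. A color-list $L$ of a graph $G$ is an assignment of lists (finite sets) of integers, called colors, to the vertices of $G$; an $a$-color-list is a color-list with $|L(v)|=a$ for every $v\in V(G)$. An $(L,b)$-coloring of $G$ is a mapping $c$ associating to each vertex $u$ a subset $c(u)\subseteq L(u)$ with $|c(u)|=b$ such that $c(u)\cap c(v)=\emptyset$ for every edge $uv\in E(G)$. The graph $G$ is free $(a,b)$-choosable if for every $a$-color-list $L$ of $G$, every vertex $v\in V(G)$ and every set $c_0\subseteq L(v)$ of $b$ colors, there exists an $(L,b)$-coloring $c$ of $G$ such that $c(v)=c_0$. For a real $x$, $\mathrm{FCH}(x)$ is the set of graphs $G$ that are free $(a,b)$-choosable for all integers $a\ge b\ge 1$ with $\frac{a}{b}\ge x$. The free-choice ratio of $G$ is $\mathrm{fchr}(G)=\inf\{\frac{a}{b} : G \text{ is free } (a,b)\text{-choosable}\}$, the infimum being over integers $a\ge b\ge 1$. $\lfloor x\rfloor$ is the greatest integer at most $x$. *)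

theory Defs
  imports "HOL-Analysis.Analysis" "Graph_Theory.Pair_Digraph"
begin

text \<open>
  A finite simple graph is a \<open>pair_graph\<close>: a finite, loop-free, symmetric set of arcs,
  an edge \<open>uv\<close> being represented by the two arcs \<open>(u, v)\<close> and \<open>(v, u)\<close>.
\<close>

definition cycle_graph :: "nat \<Rightarrow> nat pair_pre_digraph" where
  "cycle_graph n =
    \<lparr> pverts = {..<n},
      parcs = (\<Union>i<n. {(i, (i + 1) mod n), ((i + 1) mod n, i)}) \<rparr>"

text \<open>
  Colour lists and colourings are total functions; only their values on \<open>pverts G\<close> matter.
\<close>

definition color_list :: "'v pair_pre_digraph \<Rightarrow> nat \<Rightarrow> ('v \<Rightarrow> int set) \<Rightarrow> bool" where
  "color_list G a L \<longleftrightarrow> (\<forall>v\<in>pverts G. finite (L v) \<and> card (L v) = a)"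

definition list_coloring ::
    "'v pair_pre_digraph \<Rightarrow> ('v \<Rightarrow> int set) \<Rightarrow> nat \<Rightarrow> ('v \<Rightarrow> int set) \<Rightarrow> bool" where
  "list_coloring G L b c \<longleftrightarrow>
    (\<forall>u\<in>pverts G. c u \<subseteq> L u \<and> card (c u) = b) \<and>
    (\<forall>(u, v)\<in>parcs G. c u \<inter> c v = {})"

definition free_choosable :: "'v pair_pre_digraph \<Rightarrow> nat \<Rightarrow> nat \<Rightarrow> bool" where
  "free_choosable G a b \<longleftrightarrow>
    (\<forall>L. color_list G a L \<longrightarrow>
      (\<forall>v\<in>pverts G. \<forall>c0. c0 \<subseteq> L v \<and> card c0 = b \<longrightarrow>
        (\<exists>c. list_coloring G L b c \<and> c v = c0)))"

definition FCH :: "real \<Rightarrow> 'v pair_pre_digraph set" where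
  "FCH x = {G. pair_graph G \<and>
    (\<forall>a b. 1 \<le> b \<and> b \<le> a \<and> real a / real b \<ge> x \<longrightarrow> free_choosable G a b)}"

text \<open>
  The set below is bounded below by \<open>1\<close>, and it is nonempty whenever \<open>G\<close> belongs to
  some \<open>FCH x\<close>; in that case the real-valued \<open>Inf\<close> is the genuine infimum.
\<close>

definition fchr :: "'v pair_pre_digraph \<Rightarrow> real" where
  "fchr G = Inf {real a / real b |a b. 1 \<le> b \<and> b \<le> a \<and> free_choosable G a b}"

lemma pair_graph_cycle_graph: "n \<ge> 3 \<Longrightarrow> pair_graph (cycle_graph n)"
  by unfold_locales
    (auto simp: cycle_graph_def symmetric_def sym_def mod_Suc split: if_splits)

end

theory Submission
  imports Defs
begin

text \<open>
  Write \<open>a = 2 * b + e\<close> and \<open>m = n div 2\<close>, so that the ratio condition is \<open>b \<le> m * e\<close>.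
  Unroll the cycle at the precoloured vertex into a path with lists \<open>P 0, \<dots>, P n\<close>, whose
  two ends must both receive \<open>c0\<close>, and call \<open>S\<close> reachable at \<open>i\<close> if some colouring of the first
  vertices starts with \<open>c0\<close> and gives \<open>S\<close> to vertex \<open>i\<close>. By induction on \<open>k\<close> there is
  \<open>A \<subseteq> P (2 * k)\<close> of size \<open>b + e\<close> such that every \<open>b\<close>-subset of \<open>P (2 * k)\<close> meeting \<open>A\<close> in at
  most \<open>k * e\<close> colours is reachable. For \<open>k = m\<close> this is no restriction any more.

  Conversely, two vertices at distance two joined through a vertex with the same list of
  size \<open>2 * b + e\<close> have colour sets that differ in at most \<open>e\<close> colours. If \<open>m * e < b\<close>, constant
  lists defeat an odd cycle, since the last vertex would have to move from \<open>c0\<close> to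
  its complement in \<open>m\<close> such steps. On an even cycle the two neighbours of the
  precoloured vertex are given different lists, which constrain the two ends of the remaining
  path in incompatible ways.
\<close>

section \<open>Sufficiency: moving two vertices along a path\<close>

text \<open>The default choice for \<open>S\<close> is \<open>L - A\<close>, which misses
  \<open>A\<close> altogether. Exchanging up to \<open>k\<close> of its colours for colours of
  \<open>A\<close> pays for letting \<open>T\<close> meet \<open>A'\<close> in \<open>k\<close>
  colours more than \<open>e\<close>.\<close>

lemma two_step_extension:
  fixes L M :: "'a set"
  assumes fin: "finite L" "finite M"
    and card: "card L = 2 * b + e" "card M = 2 * b + e" "A \<subseteq> L" "card A = b + e"
  obtains A' where "A' \<subseteq> M" "card A' = b + e"
    "\<And>T. finite T \<Longrightarrow> card T = b \<Longrightarrow> card (T \<inter> A') \<le> k + e \<Longrightarrow>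
      \<exists>S U. S \<subseteq> L \<and> card S = b \<and> card (S \<inter> A) \<le> k \<and>
            U \<subseteq> M \<and> card U = b \<and> S \<inter> U = {} \<and> U \<inter> T = {}"
proof -
  define C where "C = L - A"
  have finA: "finite A" and finC: "finite C"
    using fin card finite_subset by (auto simp: C_def)
  have cC: "card C = b"
    using card finA by (simp add: C_def card_Diff_subset)
  have cMC: "card (M - C) + card (C \<inter> M) = 2 * b + e"
    using card_Diff_subset_Int[of M C] card_mono[of M "C \<inter> M"] fin card
    by (simp add: Int_commute)
  have cCM: "card (C \<inter> M) \<le> b"
    using card_mono[of C "C \<inter> M"] finC cC by auto
  have "card (A \<inter> M) \<le> b + e"
    using card_mono[of A "A \<inter> M"] finA card by auto
  moreover have "b + e \<le> card (M - C)"
    using cMC cCM by linarith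
  \<comment> \<open>Containing \<open>A \<inter> M\<close> makes \<open>A'\<close> and
    \<open>A\<close> overlap exactly there; avoiding \<open>C\<close> puts
    \<open>C \<inter> M\<close> among the \<open>b\<close> colours of \<open>M - A'\<close>.\<close>
  ultimately obtain A' where A': "A \<inter> M \<subseteq> A'" "A' \<subseteq> M - C" "card A' = b + e"
    using exists_subset_between[of "A \<inter> M" "b + e" "M - C"] fin by (auto simp: C_def)
  have finA': "finite A'"
    using A' fin finite_subset by blast
  have "A' \<inter> A = A \<inter> M"
    using A' by auto
  then have cdiff: "card (A' - A) = card (A - M)"
    using card_Diff_subset_Int[of A' A] card_Diff_subset_Int[of A M] finA finA' card A' by simp
  have crest: "card (M - C - A') + card (C \<inter> M) = b"
    using card_Diff_subset[of A' "M - C"] finA' A' cMC cCM by simp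
  show thesis
  proof (rule that)
    show "A' \<subseteq> M" "card A' = b + e"
      using A' by auto
    fix T assume T: "finite T" "card T = b" "card (T \<inter> A') \<le> k + e"
    \<comment> \<open>Exchanging a colour of \<open>X0\<close> in \<open>C\<close> for one of \<open>Y0\<close> frees a colour at the middle vertex.\<close>
    define X0 where "X0 = C \<inter> M - T"
    define Y0 where "Y0 = (T \<inter> A' \<inter> A) \<union> (A - M)"
    have finXY: "finite X0" "finite Y0"
      using finC finA by (auto simp: X0_def Y0_def)
    have "card (T \<inter> A') \<le> card (T \<inter> A' \<inter> A) + card (A' - A)"
      using card_mono[of "(T \<inter> A' \<inter> A) \<union> (A' - A)" "T \<inter> A'"] finA'
        card_Un_le[of "T \<inter> A' \<inter> A" "A' - A"] by fastforce
    also have "\<dots> = card (T \<inter> A' \<inter> A) + card (A - M)"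
      using cdiff by simp
    also have "\<dots> = card Y0"
      unfolding Y0_def by (rule card_Un_disjoint[symmetric]) (use A' T finA in auto)
    finally have cY0: "card (T \<inter> A') \<le> card Y0" .
    have "card (M \<inter> T) + card X0 = card ((M \<inter> T) \<union> X0)"
      by (rule card_Un_disjoint[symmetric]) (use fin finXY in \<open>auto simp: X0_def\<close>)
    also have "\<dots> \<le> card ((C \<inter> M) \<union> ((T \<inter> A') \<union> (M - C - A')))"
      by (rule card_mono) (use fin finA' in \<open>auto simp: X0_def\<close>)
    also have "\<dots> \<le> card (C \<inter> M) + (card (T \<inter> A') + card (M - C - A'))"
      by (meson add_left_mono card_Un_le order_trans)
    also have "\<dots> = b + card (T \<inter> A')"
      using crest by simp
    finally have cMT: "card (M \<inter> T) + card X0 \<le> b + card (T \<inter> A')" .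
    have cMT': "card (M \<inter> T) \<le> b"
      using card_mono[of T "M \<inter> T"] T by auto
    \<comment> \<open>Each term of the minimum leads to the bound \<open>b + e\<close> below:
      \<open>k\<close> by the assumed size of \<open>T \<inter> A'\<close>, \<open>card X0\<close>
      because only \<open>M \<inter> T\<close> remains blocked, \<open>card Y0\<close> because it is
      at least \<open>card (T \<inter> A')\<close>.\<close>
    define j where "j = min k (min (card X0) (card Y0))"
    obtain X where X: "X \<subseteq> X0" "card X = j"
      using obtain_subset_with_card_n[of j X0] unfolding j_def
      by (metis min.cobounded1 min.cobounded2 min.coboundedI2)
    obtain Y where Y: "Y \<subseteq> Y0" "card Y = j"
      using obtain_subset_with_card_n[of j Y0] unfolding j_def
      by (metis min.cobounded1 min.cobounded2 min.coboundedI2)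
    have finXY': "finite X" "finite Y"
      using X Y finXY finite_subset by auto
    define S where "S = (C - X) \<union> Y"
    have XC: "X \<subseteq> C" and YA: "Y \<subseteq> A"
      using X Y by (auto simp: X0_def Y0_def)
    have "card S = card (C - X) + card Y"
      unfolding S_def by (rule card_Un_disjoint) (use finC finXY' YA in \<open>auto simp: C_def\<close>)
    moreover have "card (C - X) = b - j" "j \<le> b"
      using card_Diff_subset[of X C] XC finXY' X cC card_mono[of C X] finC by auto
    ultimately have cS: "card S = b"
      using Y by simp
    have "S \<inter> A = Y"
      using YA by (auto simp: S_def C_def)
    then have cSA: "card (S \<inter> A) \<le> k"
      using Y by (simp add: j_def)
    have SL: "S \<subseteq> L"
      using YA card by (auto simp: S_def C_def)
    have finS: "finite S"
      using SL fin finite_subset by blast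
    \<comment> \<open>The colours of \<open>Y\<close> lie in \<open>T\<close> or outside
      \<open>M\<close>, so they block nothing new in \<open>M\<close>.\<close>
    have "card (M \<inter> (S \<union> T)) \<le> card ((M \<inter> T) \<union> (X0 - X))"
      by (rule card_mono) (use fin finXY X Y in \<open>auto simp: S_def X0_def Y0_def\<close>)
    also have "\<dots> \<le> card (M \<inter> T) + card (X0 - X)"
      by (rule card_Un_le)
    also have "\<dots> = card (M \<inter> T) + (card X0 - j)"
      using card_Diff_subset[of X X0] X finXY' by simp
    also have "\<dots> \<le> b + e"
      using cMT cMT' T(3) cY0 by (auto simp: j_def min_def)
    finally have "b \<le> card (M - (S \<union> T))"
      using card_Diff_subset_Int[of M "S \<union> T"] fin card by simp
    then obtain U where "U \<subseteq> M - (S \<union> T)" "card U = b"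
      using obtain_subset_with_card_n by metis
    then show "\<exists>S U. S \<subseteq> L \<and> card S = b \<and> card (S \<inter> A) \<le> k \<and>
            U \<subseteq> M \<and> card U = b \<and> S \<inter> U = {} \<and> U \<inter> T = {}"
      using SL cS cSA by (intro exI[of _ S] exI[of _ U]) auto
  qed
qed

section \<open>Reachable colour sets along the unrolled cycle\<close>

text \<open>Only the last set is kept, since the next step depends on nothing else. Closing the
  cycle then means reaching \<open>c0\<close> again at index \<open>n\<close>.\<close>

inductive reachable :: "(nat \<Rightarrow> 'a set) \<Rightarrow> nat \<Rightarrow> 'a set \<Rightarrow> nat \<Rightarrow> 'a set \<Rightarrow> bool"
  for P b c0 where
  start: "c0 \<subseteq> P 0 \<Longrightarrow> card c0 = b \<Longrightarrow> reachable P b c0 0 c0"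
| step: "reachable P b c0 i S \<Longrightarrow> T \<subseteq> P (Suc i) \<Longrightarrow> card T = b \<Longrightarrow> S \<inter> T = {} \<Longrightarrow>
    reachable P b c0 (Suc i) T"

lemma reachable_imp_coloring:
  assumes "reachable P b c0 i S"
  shows "\<exists>f. f 0 = c0 \<and> f i = S \<and> (\<forall>j\<le>i. f j \<subseteq> P j \<and> card (f j) = b) \<and>
    (\<forall>j<i. f j \<inter> f (Suc j) = {})"
  using assms
proof induction
  case start
  then show ?case by auto
next
  case (step i S T)
  then obtain f where f: "f 0 = c0" "f i = S" "\<forall>j\<le>i. f j \<subseteq> P j \<and> card (f j) = b"
    "\<forall>j<i. f j \<inter> f (Suc j) = {}" by blast
  show ?case
    by (rule exI[of _ "f(Suc i := T)"]) (use f step in \<open>auto simp: less_Suc_eq le_Suc_eq\<close>)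
qed

text \<open>At \<open>k = 0\<close> take \<open>A = P 0 - c0\<close>: a \<open>b\<close>-subset of
  \<open>P 0\<close> missing it must be \<open>c0\<close>. Each further pair of vertices raises the
  bound by \<open>e\<close> through \<open>two_step_extension\<close>.\<close>

lemma reachable_even:
  fixes P :: "nat \<Rightarrow> 'a set"
  assumes P: "\<And>i. finite (P i)" "\<And>i. card (P i) = 2 * b + e"
    and c0: "c0 \<subseteq> P 0" "card c0 = b"
  shows "\<exists>A\<subseteq>P (2 * k). card A = b + e \<and>
    (\<forall>S. S \<subseteq> P (2 * k) \<and> card S = b \<and> card (S \<inter> A) \<le> k * e \<longrightarrow> reachable P b c0 (2 * k) S)"
proof (induction k)
  case 0
  have fin: "finite c0"
    using P c0 finite_subset by blast
  have "S = c0" if "S \<subseteq> P 0" "card S = b" "card (S \<inter> (P 0 - c0)) = 0" for S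
  proof -
    have "finite S"
      using that P finite_subset by blast
    then have "S \<subseteq> c0"
      using that by auto
    then show ?thesis
      using card_subset_eq[OF fin] that c0 by auto
  qed
  then show ?case
    using P c0 fin reachable.start[of c0 P b]
    by (intro exI[of _ "P 0 - c0"]) (auto simp: card_Diff_subset)
next
  case (Suc k)
  then obtain A where A: "A \<subseteq> P (2 * k)" "card A = b + e"
    "\<forall>S. S \<subseteq> P (2 * k) \<and> card S = b \<and> card (S \<inter> A) \<le> k * e \<longrightarrow> reachable P b c0 (2 * k) S"
    by (elim exE conjE)
  obtain A' where A': "A' \<subseteq> P (Suc (2 * k))" "card A' = b + e"
    "\<And>T. finite T \<Longrightarrow> card T = b \<Longrightarrow> card (T \<inter> A') \<le> k * e + e \<Longrightarrow>
      \<exists>S U. S \<subseteq> P (2 * k) \<and> card S = b \<and> card (S \<inter> A) \<le> k * e \<and>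
            U \<subseteq> P (Suc (2 * k)) \<and> card U = b \<and> S \<inter> U = {} \<and> U \<inter> T = {}"
    by (rule two_step_extension[OF P(1) P(1) P(2) P(2) A(1) A(2)]) blast
  have "finite A'"
    using A'(1) P(1) by (rule finite_subset)
  then have "card (A' \<inter> P (2 * Suc k)) \<le> b + e"
    using card_mono[of A' "A' \<inter> P (2 * Suc k)"] A'(2) by auto
  \<comment> \<open>\<open>A'\<close> lies in the list of the middle vertex, while the invariant
    wants a subset of \<open>P (2 * Suc k)\<close>. Covering the common part suffices, since
    \<open>T \<inter> A' \<subseteq> T \<inter> A2\<close> for every \<open>T\<close> in that
    list.\<close>
  then obtain A2 where A2: "A' \<inter> P (2 * Suc k) \<subseteq> A2" "A2 \<subseteq> P (2 * Suc k)" "card A2 = b + e"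
    using exists_subset_between[of "A' \<inter> P (2 * Suc k)" "b + e" "P (2 * Suc k)"] P by auto
  have "reachable P b c0 (2 * Suc k) T"
    if T: "T \<subseteq> P (2 * Suc k)" "card T = b" "card (T \<inter> A2) \<le> Suc k * e" for T
  proof -
    have finT: "finite T"
      using T P finite_subset by blast
    have "card (T \<inter> A') \<le> card (T \<inter> A2)"
      by (rule card_mono) (use finT T A2 in auto)
    then obtain S U where SU: "S \<subseteq> P (2 * k)" "card S = b" "card (S \<inter> A) \<le> k * e"
      "U \<subseteq> P (Suc (2 * k))" "card U = b" "S \<inter> U = {}" "U \<inter> T = {}"
      using A'(3)[of T] finT T by auto
    then have "reachable P b c0 (Suc (2 * k)) U"
      using A(3) by (intro reachable.step[of P b c0 "2 * k" S U]) auto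
    then have "reachable P b c0 (Suc (Suc (2 * k))) T"
      using SU T by (intro reachable.step[of P b c0 "Suc (2 * k)" U T]) auto
    then show ?thesis by simp
  qed
  then show ?case
    using A2 by blast
qed

lemma closed_walk_reachable:
  fixes P :: "nat \<Rightarrow> 'a set"
  assumes P: "\<And>i. finite (P i)" "\<And>i. card (P i) = 2 * b + e"
    and c0: "c0 \<subseteq> P 0" "card c0 = b" and Pn: "P n = P 0" and e: "b \<le> (n div 2) * e"
  shows "reachable P b c0 n c0"
proof -
  let ?m = "n div 2"
  have all: "reachable P b c0 (2 * ?m) S" if S: "S \<subseteq> P (2 * ?m)" "card S = b" for S
  proof -
    have "finite S"
      using S P finite_subset by blast
    then have "card (S \<inter> A) \<le> ?m * e" for A
      using card_mono[of S "S \<inter> A"] S e by auto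
    then show ?thesis
      using reachable_even[where P = P and b = b and e = e, OF P c0, of ?m] S by blast
  qed
  show ?thesis
  proof (cases "even n")
    case True
    then show ?thesis
      using all[of c0] c0 Pn by simp
  next
    case False
    have fin: "finite c0"
      using P c0 finite_subset by blast
    have "card (P (2 * ?m) \<inter> c0) \<le> b"
      using card_mono[of c0 "P (2 * ?m) \<inter> c0"] fin c0 by auto
    then have "b \<le> card (P (2 * ?m) - c0)"
      using card_Diff_subset_Int[of "P (2 * ?m)" c0] P by simp
    \<comment> \<open>For odd \<open>n\<close> one step is left over; any \<open>b\<close>-set at
      position \<open>n - 1\<close> that avoids \<open>c0\<close> is reachable and can be followed
      by \<open>c0\<close>.\<close>
    then obtain S where S: "S \<subseteq> P (2 * ?m) - c0" "card S = b"
      using obtain_subset_with_card_n by metis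
    have "reachable P b c0 (Suc (2 * ?m)) c0"
      by (rule reachable.step[OF all[of S]]) (use S c0 Pn False in auto)
    then show ?thesis
      using False by simp
  qed
qed

section \<open>From closed walks to colourings of the cycle\<close>

lemma cycle_free_choosable:
  assumes n: "n \<ge> 3" and e: "b \<le> (n div 2) * e"
  shows "free_choosable (cycle_graph n) (2 * b + e) b"
  unfolding free_choosable_def
proof (intro allI impI ballI)
  fix L v c0
  assume L: "color_list (cycle_graph n) (2 * b + e) L" and v: "v \<in> pverts (cycle_graph n)"
    and c0: "c0 \<subseteq> L v \<and> card c0 = b"
  have vn: "v < n"
    using v by (simp add: cycle_graph_def)
  define P where "P i = L ((v + i) mod n)" for i
  have "finite (P i)" "card (P i) = 2 * b + e" for i
    using L n by (auto simp: P_def color_list_def cycle_graph_def)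
  then have "reachable P b c0 n c0"
    using c0 vn e by (intro closed_walk_reachable) (auto simp: P_def)
  then obtain f where f: "f 0 = c0" "f n = c0" "\<And>j. j \<le> n \<Longrightarrow> f j \<subseteq> P j \<and> card (f j) = b"
    "\<And>j. j < n \<Longrightarrow> f j \<inter> f (Suc j) = {}"
    by (auto dest!: reachable_imp_coloring)
  \<comment> \<open>The position of \<open>u\<close> when counting starts at \<open>v\<close>;
    adding \<open>n - v\<close> replaces the subtraction of \<open>v\<close>, which would
    truncate.\<close>
  define r where "r u = (u + (n - v)) mod n" for u
  define c where "c u = f (r u)" for u
  have r: "r u < n" for u
    using n by (simp add: r_def)
  have "(v + r u) mod n = u" if "u < n" for u
  proof -
    have "(v + r u) mod n = (v + (u + (n - v))) mod n"
      unfolding r_def by (rule mod_add_right_eq)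
    also have "\<dots> = u"
      using that vn by simp
    finally show ?thesis .
  qed
  then have cL: "c u \<subseteq> L u" "card (c u) = b" if "u < n" for u
    using f(3)[of "r u"] r[of u] that by (auto simp: c_def P_def)
  have edge: "c u \<inter> c ((u + 1) mod n) = {}" for u
  proof -
    have "r ((u + 1) mod n) = (r u + 1) mod n"
      unfolding r_def by (simp add: mod_simps add.commute)
    \<comment> \<open>On the edge that returns to \<open>v\<close> this is
      \<open>f 0 = f n\<close>.\<close>
    then have "f (r ((u + 1) mod n)) = f (Suc (r u))"
      using r[of u] f(1,2) by (cases "Suc (r u) = n") auto
    then show ?thesis
      using f(4) r by (simp add: c_def)
  qed
  have "list_coloring (cycle_graph n) L b c"
    using cL edge unfolding list_coloring_def cycle_graph_def by (auto simp: Int_commute)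
  moreover have "c v = c0"
    using f vn by (simp add: c_def r_def)
  ultimately show "\<exists>c. list_coloring (cycle_graph n) L b c \<and> c v = c0"
    by blast
qed

section \<open>Necessity: lists that defeat smaller ratios\<close>

text \<open>The set at \<open>i + 2\<close> avoids the one at \<open>i + 1\<close>, so its colours
  outside \<open>f i\<close> are among the \<open>e\<close> colours of \<open>X\<close> used at
  neither \<open>i\<close> nor \<open>i + 1\<close>.\<close>

lemma card_Int_two_step:
  assumes X: "finite X" "card X = 2 * b + e"
    and f: "\<And>i. p \<le> i \<Longrightarrow> i \<le> p + 2 * k \<Longrightarrow> f i \<subseteq> X \<and> card (f i) = b"
      "\<And>i. p \<le> i \<Longrightarrow> i < p + 2 * k \<Longrightarrow> f i \<inter> f (Suc i) = {}"
  shows "card (f (p + 2 * k) \<inter> A) \<le> card (f p \<inter> A) + k * e"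
  using f
proof (induction k)
  case 0
  then show ?case by simp
next
  case (Suc k)
  let ?i = "p + 2 * k"
  have IH: "card (f ?i \<inter> A) \<le> card (f p \<inter> A) + k * e"
    by (rule Suc.IH) (use Suc.prems in auto)
  have sub: "f ?i \<subseteq> X" "f (Suc ?i) \<subseteq> X" "f (Suc (Suc ?i)) \<subseteq> X"
    and c: "card (f ?i) = b" "card (f (Suc ?i)) = b"
    using Suc.prems(1)[of ?i] Suc.prems(1)[of "Suc ?i"] Suc.prems(1)[of "Suc (Suc ?i)"] by auto
  have disj: "f ?i \<inter> f (Suc ?i) = {}" "f (Suc ?i) \<inter> f (Suc (Suc ?i)) = {}"
    using Suc.prems(2)[of ?i] Suc.prems(2)[of "Suc ?i"] by auto
  have fin: "finite (f ?i)" "finite (f (Suc ?i))" "finite (f (Suc (Suc ?i)))"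
    using sub X by (simp_all add: finite_subset)
  have "card (f (Suc (Suc ?i)) - f ?i) \<le> card (X - (f ?i \<union> f (Suc ?i)))"
    by (rule card_mono) (use X sub disj in auto)
  also have "\<dots> = e"
    using X sub c fin disj by (simp add: card_Diff_subset card_Un_disjoint)
  finally have new: "card (f (Suc (Suc ?i)) - f ?i) \<le> e" .
  have "card (f (Suc (Suc ?i)) \<inter> A) \<le> card ((f ?i \<inter> A) \<union> (f (Suc (Suc ?i)) - f ?i))"
    by (rule card_mono) (use fin in auto)
  also have "\<dots> \<le> card (f ?i \<inter> A) + card (f (Suc (Suc ?i)) - f ?i)"
    by (rule card_Un_le)
  finally show ?case
    using IH new by simp
qed

lemma free_choosable_cycleE:
  fixes L :: "nat \<Rightarrow> int set"
  assumes fc: "free_choosable (cycle_graph n) a b" and n: "n \<ge> 3"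
    and L: "\<And>i. i < n \<Longrightarrow> finite (L i) \<and> card (L i) = a" and c0: "c0 \<subseteq> L 0" "card c0 = b"
  obtains c where "c 0 = c0" "\<And>i. i < n \<Longrightarrow> c i \<subseteq> L i \<and> card (c i) = b"
    "\<And>i. Suc i < n \<Longrightarrow> c i \<inter> c (Suc i) = {}" "c (n - 1) \<inter> c0 = {}"
proof -
  have "color_list (cycle_graph n) a L" "0 \<in> pverts (cycle_graph n)"
    using L n by (auto simp: color_list_def cycle_graph_def)
  then obtain c where c: "list_coloring (cycle_graph n) L b c" "c 0 = c0"
    using fc c0 unfolding free_choosable_def by blast
  have edge: "c i \<inter> c ((i + 1) mod n) = {}" if "i < n" for i
    using c(1) that unfolding list_coloring_def cycle_graph_def by fastforce
  show thesis
  proof (rule that)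
    show "c 0 = c0" by fact
    show "c i \<subseteq> L i \<and> card (c i) = b" if "i < n" for i
      using c(1) that by (auto simp: list_coloring_def cycle_graph_def)
    show "c i \<inter> c (Suc i) = {}" if "Suc i < n" for i
      using edge[of i] that by simp
    show "c (n - 1) \<inter> c0 = {}"
      using edge[of "n - 1"] n c(2) by simp
  qed
qed

lemma free_choosable_cycle_double:
  assumes fc: "free_choosable (cycle_graph n) a b" and n: "n \<ge> 3" and ba: "b \<le> a"
  shows "2 * b \<le> a"
proof -
  let ?X = "{0..<int a}" and ?C = "{0..<int b}"
  obtain c where c: "c 0 = ?C" "\<And>i. i < n \<Longrightarrow> c i \<subseteq> ?X \<and> card (c i) = b"
    "\<And>i. Suc i < n \<Longrightarrow> c i \<inter> c (Suc i) = {}"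
    by (rule free_choosable_cycleE[OF fc n, of "\<lambda>_. ?X" ?C]) (use ba in auto)
  have sub: "c 0 \<subseteq> ?X" "c 1 \<subseteq> ?X" and cc: "card (c 0) = b" "card (c 1) = b"
    and d: "c 0 \<inter> c 1 = {}"
    using c(2)[of 0] c(2)[of 1] c(3)[of 0] n by auto
  have "finite (c 0)" "finite (c 1)"
    using sub finite_subset by blast+
  then have "card (c 0 \<union> c 1) = 2 * b"
    using cc d by (simp add: card_Un_disjoint)
  moreover have "card (c 0 \<union> c 1) \<le> card ?X"
    by (rule card_mono) (use sub in auto)
  ultimately show ?thesis by simp
qed

lemma free_choosable_odd_cycle:
  assumes fc: "free_choosable (cycle_graph n) (2 * b + e) b" and n: "n \<ge> 3" "odd n"
  shows "b \<le> (n div 2) * e"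
proof -
  let ?X = "{0..<2 * int b + int e}" and ?C = "{0..<int b}" and ?m = "n div 2"
  obtain c where c: "c 0 = ?C" "\<And>i. i < n \<Longrightarrow> c i \<subseteq> ?X \<and> card (c i) = b"
    "\<And>i. Suc i < n \<Longrightarrow> c i \<inter> c (Suc i) = {}" "c (n - 1) \<inter> ?C = {}"
    using free_choosable_cycleE[OF fc n(1), of "\<lambda>_. ?X" ?C] by (auto simp: nat_add_distrib nat_mult_distrib)
  have nm: "n = Suc (2 * ?m)"
    using n by simp
  \<comment> \<open>The colours outside \<open>?C\<close> are counted: none at vertex
    \<open>0\<close>, all \<open>b\<close> at its neighbour \<open>n - 1 = 2 * ?m\<close>.\<close>
  have "card (c (0 + 2 * ?m) \<inter> (?X - ?C)) \<le> card (c 0 \<inter> (?X - ?C)) + ?m * e"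
    by (rule card_Int_two_step[of ?X b]) (use c nm in \<open>auto simp: nat_add_distrib nat_mult_distrib\<close>)
  moreover have "c 0 \<inter> (?X - ?C) = {}"
    using c(1) by auto
  moreover have "c (2 * ?m) \<subseteq> ?X - ?C"
  proof -
    have last: "n - 1 = 2 * ?m"
      using n by simp
    have "c (n - 1) \<subseteq> ?X"
      using c(2)[of "n - 1"] n by simp
    then have "c (n - 1) \<subseteq> ?X - ?C"
      using c(4) by blast
    then show ?thesis
      unfolding last .
  qed
  ultimately show ?thesis
    using c(2)[of "2 * ?m"] nm by (simp add: Int_absorb2)
qed

text \<open>Vertices \<open>1\<close> and \<open>n - 1\<close> must colour from \<open>A\<close> and
  \<open>A'\<close>. At vertex \<open>n - 2\<close> this allows at most \<open>e + k * e\<close>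
  colours in \<open>A\<close> and \<open>e\<close> in \<open>A'\<close>, hence at most
  \<open>(k + 2) * e\<close> in all.\<close>

lemma free_choosable_even_cycle:
  assumes fc: "free_choosable (cycle_graph n) (2 * b + e) b" and n: "n \<ge> 3" "even n"
  shows "b \<le> (n div 2) * e"
proof -
  \<comment> \<open>\<open>A\<close> and \<open>A'\<close> have size \<open>b + e\<close>, cover
    \<open>X\<close> and share \<open>e\<close> colours; \<open>C\<close> is disjoint from both and
    serves as the prescribed set.\<close>
  define A where "A = {int b..<2 * int b + int e}"
  define A' where "A' = {2 * int b..<3 * int b + int e}"
  define C where "C = {0..<int b}"
  define X where "X = {int b..<3 * int b + int e}"
  define L where "L i = (if i \<le> 1 then C \<union> A else if i = n - 1 then C \<union> A' else X)" for i
  have card: "card A = b + e" "card A' = b + e" "card C = b" "card X = 2 * b + e"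
    by (simp_all add: A_def A'_def C_def X_def nat_add_distrib nat_mult_distrib)
  have fin: "finite A" "finite A'" "finite C" "finite X"
    by (simp_all add: A_def A'_def C_def X_def)
  have "C \<inter> A = {}" "C \<inter> A' = {}"
    by (auto simp: A_def A'_def C_def)
  then have cL: "finite (L i) \<and> card (L i) = 2 * b + e" for i
    using card fin by (simp add: L_def card_Un_disjoint)
  obtain c where c: "c 0 = C" "\<And>i. i < n \<Longrightarrow> c i \<subseteq> L i \<and> card (c i) = b"
    "\<And>i. Suc i < n \<Longrightarrow> c i \<inter> c (Suc i) = {}" "c (n - 1) \<inter> C = {}"
    using free_choosable_cycleE[OF fc n(1), of L C] cL card by (auto simp: L_def)
  define k where "k = n div 2 - 2"
  have nk: "n = 2 * k + 4"
    using n by (auto simp: k_def elim!: evenE)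
  \<comment> \<open>A \<open>b\<close>-set \<open>T\<close> inside \<open>B\<close> leaves only
    \<open>e\<close> colours of \<open>B\<close> for a neighbour.\<close>
  have end_card: "card (S \<inter> B) \<le> e"
    if "S \<inter> T = {}" "T \<subseteq> B" "card T = b" "card B = b + e" "finite B" for S T B :: "int set"
  proof -
    have "card (S \<inter> B) \<le> card (B - T)"
      by (rule card_mono) (use that in auto)
    also have "\<dots> = e"
      using that finite_subset[of T B] by (simp add: card_Diff_subset)
    finally show ?thesis .
  qed
  let ?l = "2 + 2 * k"
  have "card (c 2 \<inter> A) \<le> e"
  proof (rule end_card)
    show "c 2 \<inter> c 1 = {}" "c 1 \<subseteq> A" "card (c 1) = b"
      using c(1) c(2)[of 1] c(3)[of 0] c(3)[of 1] n
      by (auto simp: L_def numeral_2_eq_2)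
  qed (use card fin in auto)
  moreover have "card (c ?l \<inter> A) \<le> card (c 2 \<inter> A) + k * e"
  proof (rule card_Int_two_step[of X b])
    show "c i \<subseteq> X \<and> card (c i) = b" if "2 \<le> i" "i \<le> 2 + 2 * k" for i
      using c(2)[of i] that nk by (auto simp: L_def)
    show "c i \<inter> c (Suc i) = {}" if "2 \<le> i" "i < 2 + 2 * k" for i
      using c(3)[of i] that nk by auto
  qed (use fin card in auto)
  moreover have "card (c ?l \<inter> A') \<le> e"
  proof (rule end_card)
    have last: "n - 1 = Suc ?l"
      using nk by simp
    show "c ?l \<inter> c (n - 1) = {}"
      unfolding last by (rule c(3)) (simp add: nk)
    have "L (n - 1) = C \<union> A'"
      using nk by (simp add: L_def)
    then have "c (n - 1) \<subseteq> C \<union> A'" "card (c (n - 1)) = b"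
      using c(2)[of "n - 1"] n by auto
    then show "c (n - 1) \<subseteq> A'" "card (c (n - 1)) = b"
      using c(4) by auto
  qed (use card fin in auto)
  moreover have "b \<le> card (c ?l \<inter> A) + card (c ?l \<inter> A')"
  proof -
    have "c ?l \<subseteq> X" and cb: "card (c ?l) = b"
      using c(2)[of ?l] nk by (auto simp: L_def)
    moreover have "X = A \<union> A'"
      by (auto simp: X_def A_def A'_def)
    ultimately have "c ?l = (c ?l \<inter> A) \<union> (c ?l \<inter> A')"
      by blast
    then show ?thesis
      using card_Un_le[of "c ?l \<inter> A" "c ?l \<inter> A'"] cb by simp
  qed
  moreover have "n div 2 = k + 2"
    using nk by simp
  ultimately show ?thesis
    by (simp add: algebra_simps)
qed

section \<open>The exact threshold and the infimum\<close>

lemma ratio_ge_iff: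
  fixes a b m :: nat
  assumes "b > 0" "m > 0" "2 * b \<le> a"
  shows "2 + inverse (real m) \<le> real a / real b \<longleftrightarrow> b \<le> m * (a - 2 * b)"
proof -
  obtain e where a: "a = 2 * b + e"
    using assms(3) le_Suc_ex by blast
  have "2 + inverse (real m) \<le> real a / real b \<longleftrightarrow> real b \<le> real m * real e"
    using assms by (simp add: a field_simps)
  also have "\<dots> \<longleftrightarrow> b \<le> m * e"
    by (metis of_nat_le_iff of_nat_mult)
  finally show ?thesis
    by (simp add: a)
qed

lemma free_choosable_cycle_iff:
  assumes n: "n \<ge> 3" and ab: "1 \<le> b" "b \<le> a"
  shows "free_choosable (cycle_graph n) a b \<longleftrightarrow>
    2 + inverse (real (n div 2)) \<le> real a / real b"
proof (cases "2 * b \<le> a")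
  case True
  then obtain e where a: "a = 2 * b + e"
    using le_Suc_ex by blast
  have "free_choosable (cycle_graph n) a b \<longleftrightarrow> b \<le> (n div 2) * e"
    unfolding a using cycle_free_choosable free_choosable_odd_cycle free_choosable_even_cycle n
    by blast
  then show ?thesis
    using ratio_ge_iff[of b "n div 2" a] n ab True by (simp add: a)
next
  case False
  \<comment> \<open>Here both sides of the equivalence fail, as adjacent vertices with equal lists
    already need \<open>2 * b\<close> colours.\<close>
  then have "real a / real b < 2"
    using ab by (simp add: field_simps)
  moreover have "0 < inverse (real (n div 2))"
    using n by simp
  ultimately show ?thesis
    using False free_choosable_cycle_double[OF _ n ab(2)] by fastforce
qed

theorem theorem4:
  fixes n :: nat
  assumes "n \<ge> 3"
  shows "cycle_graph n \<in> FCH (2 + inverse (real_of_int \<lfloor>real n / 2\<rfloor>))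
    \<and> fchr (cycle_graph n) = 2 + inverse (real_of_int \<lfloor>real n / 2\<rfloor>)"
proof -
  let ?m = "n div 2"
  let ?x = "2 + inverse (real ?m)"
  have m: "?m > 0"
    using assms by simp
  have floor: "real_of_int \<lfloor>real n / 2\<rfloor> = real ?m"
    using floor_divide_of_nat_eq[of n 2, where 'a = real] by simp
  \<comment> \<open>The infimum is attained, at \<open>a = 2 * ?m + 1\<close> and
    \<open>b = ?m\<close>.\<close>
  have "real (2 * ?m + 1) / real ?m = ?x"
    using m by (simp add: field_simps)
  then have "?x \<in> {real a / real b |a b. 1 \<le> b \<and> b \<le> a \<and> free_choosable (cycle_graph n) a b}"
    using m by (intro CollectI exI[of _ "2 * ?m + 1"] exI[of _ ?m])
      (auto simp: free_choosable_cycle_iff[OF assms])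
  then have "fchr (cycle_graph n) = ?x"
    unfolding fchr_def by (rule cInf_eq_minimum) (auto simp: free_choosable_cycle_iff[OF assms])
  moreover have "cycle_graph n \<in> FCH ?x"
    using pair_graph_cycle_graph[OF assms] free_choosable_cycle_iff[OF assms]
    by (auto simp: FCH_def)
  ultimately show ?thesis
    by (simp add: floor)
qed

end
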